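(* Suppose there exists $x'\in[K]$ such that for any $x\in[K]$, any $t,M\in\mathbb N$ and $z\in[K]^t$, $$I_x+\sum_{s=1}^M\omega\big(\pi_{t+s}(z,x,x',\dots,x')\big)\le I_{x'}+\sum_{s=1}^M\omega\big(\pi_{t+s}(z,x',x',\dots,x')\big).$$ Then: (i) for any $t,M\in\mathbb N$, $z\in[K]^t$ and $(x_{t+1},\dots,x_{t+M})\in[K]^M$, $$\sum_{s=1}^M\big(I_{x_{t+s}}+\omega(\pi_{t+s}(z,x_{t+1},\dots,x_{t+s}))\big)\le\sum_{s=1}^M\big(I_{x'}+\omega(\pi_{t+s}(z,x',\dots,x'))\big);$$ (ii) for any $t\in\mathbb N$ and $z\in[K]^t$, the constant sequence $(x',x',\dots)$ solves $$\sup_{(x_{t+1},x_{t+2},\dots)\in[K]^\infty}\ \liminf_{M\to\infty}\frac1M\sum_{s=1}^M\big(I_{x_{t+s}}+\omega(\pi_{t+s}(z,x_{t+1},\dots,x_{t+s}))\big);$$ (iii) the block of length one $\Xi_2=(x')$ maximizes $\mathsf D(\Xi)$ over all blocks $\Xi\in[K]^\ell$, $\ell\in\mathbb N$.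
   Context: Fix $K\ge2$, $[K]=\{1,\dots,K\}$, $\mathbb N=\{1,2,\dots\}$. The change-point model is given by functions $\pi_t:[K]^t\to[0,1)$, $t\in\mathbb N$: $\pi_t(x_1,\dots,x_t)$ is the conditional probability that the change occurs at time $t$, given that it has not occurred before and that the first $t$ treatments are $x_1,\dots,x_t$. In $\pi_{t+s}(z,\cdot)$ the first $t$ treatments are $z$ and the remaining $s$ are as listed. $I_x\in(0,\infty)$ is the Kullback-Leibler divergence $\int\log(g_x/f_x)g_x\,d\mu$ between the post-change and pre-change response densities under treatment $x\in[K]$. $\omega(x)=|\log(1-x)|$. A block is $\Xi\in[K]^\ell$, extended cyclically ($\Xi(m\ell+i)=\Xi(i)$), $\Xi(i:j)=(\Xi(i),\dots,\Xi(j))$. Standing assumption: for each block $\Xi\in[K]^\ell$ there is $d(\Xi)\ge0$ with $\lim_{M\to\infty}\frac1M\sum_{s=1}^M\omega(\pi_{t+s}(z,\Xi(j:s+j-1)))=d(\Xi)$, uniformly in $t\ge0$, $z\in[K]^t$, $j\in\{1,\dots,\ell\}$. $\mathsf D(\Xi)=\frac1\ell\sum_{i=1}^\ell I_{\Xi(i)}+d(\Xi)$. *)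

theory Defs
  imports "HOL-Probability.Probability" "HOL-Library.NList"
begin

text \<open>
  The treatment set \<open>[K]\<close> is \<open>{1..K}\<close> and \<open>[K]\<^sup>t\<close> is \<open>nlists t {1..K}\<close>. The family
  \<open>\<pi>\<^sub>t : [K]\<^sup>t \<rightarrow> [0,1)\<close>, \<open>t \<ge> 1\<close>, is a single function on lists, the index being the length;
  its value at the empty list is irrelevant.
\<close>

definition omega :: "real \<Rightarrow> real" where
  "omega x = \<bar>ln (1 - x)\<bar>"

definition prob_density :: "'a measure \<Rightarrow> ('a \<Rightarrow> real) \<Rightarrow> bool" where
  "prob_density \<mu> f \<longleftrightarrow>
     f \<in> borel_measurable \<mu> \<and> (\<forall>y\<in>space \<mu>. 0 \<le> f y) \<and> (\<integral>\<^sup>+ y. ennreal (f y) \<partial>\<mu>) = 1"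

definition KL_info :: "'a measure \<Rightarrow> ('a \<Rightarrow> real) \<Rightarrow> ('a \<Rightarrow> real) \<Rightarrow> real" where
  "KL_info \<mu> f g = (\<integral>y. ln (g y / f y) * g y \<partial>\<mu>)"

text \<open>
  Finiteness of the divergence. The null-set condition is needed because \<open>ln (g y / 0) = 0\<close>
  in HOL, whereas mathematically the divergence is infinite if \<open>g > 0 = f\<close> on a set of
  positive measure.
\<close>

definition KL_finite :: "'a measure \<Rightarrow> ('a \<Rightarrow> real) \<Rightarrow> ('a \<Rightarrow> real) \<Rightarrow> bool" where
  "KL_finite \<mu> f g \<longleftrightarrow>
     (AE y in \<mu>. f y = 0 \<longrightarrow> g y = 0) \<and> integrable \<mu> (\<lambda>y. ln (g y / f y) * g y)"

definition cyc :: "nat list \<Rightarrow> nat \<Rightarrow> nat" where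
  "cyc \<Xi> n = \<Xi> ! ((n - 1) mod length \<Xi>)"

definition cyc_seg :: "nat list \<Rightarrow> nat \<Rightarrow> nat \<Rightarrow> nat list" where
  "cyc_seg \<Xi> i j = map (cyc \<Xi>) [i..<j + 1]"

text \<open>
  The uniformity in \<open>t \<ge> 0\<close> and \<open>z \<in> [K]\<^sup>t\<close> is uniformity over all lists \<open>z\<close> with entries in
  \<open>[K]\<close>, the empty one included.
\<close>

definition block_rate :: "nat \<Rightarrow> (nat list \<Rightarrow> real) \<Rightarrow> nat list \<Rightarrow> real \<Rightarrow> bool" where
  "block_rate K \<pi> \<Xi> r \<longleftrightarrow>
     uniform_limit (lists {1..K} \<times> {1..length \<Xi>})
       (\<lambda>M (z, j). (1 / real M) * (\<Sum>s=1..M. omega (\<pi> (z @ cyc_seg \<Xi> j (s + j - 1)))))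
       (\<lambda>_. r) sequentially"

definition block_D :: "(nat \<Rightarrow> real) \<Rightarrow> (nat list \<Rightarrow> real) \<Rightarrow> nat list \<Rightarrow> real" where
  "block_D I d \<Xi> = (1 / real (length \<Xi>)) * (\<Sum>i=1..length \<Xi>. I (cyc \<Xi> i)) + d \<Xi>"

text \<open>
  With \<open>t = length z\<close>, only the values \<open>x (t + 1), x (t + 2), \<dots>\<close> of the sequence \<open>x\<close> matter.
\<close>

definition avg_gain ::
    "(nat \<Rightarrow> real) \<Rightarrow> (nat list \<Rightarrow> real) \<Rightarrow> nat list \<Rightarrow> (nat \<Rightarrow> nat) \<Rightarrow> ereal" where
  "avg_gain I \<pi> z x = liminf (\<lambda>M. ereal ((1 / real M) *
     (\<Sum>s=1..M. I (x (length z + s))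
        + omega (\<pi> (z @ map x [length z + 1..<length z + s + 1])))))"

end

theory Submission imports Defs begin

text \<open>
  The hypothesis says that replacing a single treatment, followed by \<open>x'\<close> forever, by \<open>x'\<close> never
  lowers the gain. Replacing the treatments one at a time, starting with the last one, proves (i),
  and (ii) follows by passing to the limit inferior. For (iii), both values of \<open>block_D\<close> are limits of
  average gains along the multiples of the block length, to which (i) applies.
\<close>

\<comment> \<open>As rewrite rules, their premises with free \<open>n\<close> and \<open>A\<close> make the simplifier loop.\<close>
declare nlistsE_length [simp del] nlistsE_set [simp del]

text \<open>The premise guards against truncated subtraction in \<open>cyc\<close>: for a nonempty
  block, \<open>i = 0\<close> and \<open>m \<ge> 1\<close>, the left side would be the last entry
  and the right side the first.\<close>

lemma cyc_add_period:
  assumes "i \<ge> 1"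
  shows "cyc \<Xi> (m * length \<Xi> + i) = cyc \<Xi> i"
proof -
  have "m * length \<Xi> + i - 1 = (i - 1) + m * length \<Xi>"
    using assms by simp
  then show ?thesis
    by (simp add: cyc_def)
qed

lemma cyc_in_set:
  assumes "\<Xi> \<noteq> []"
  shows "cyc \<Xi> n \<in> set \<Xi>"
  using assms by (simp add: cyc_def)

lemma cyc_singleton [simp]: "cyc [a] n = a"
  by (simp add: cyc_def)

text \<open>Over whole periods the divergence part of the average is exact, so it leaves no error
  term in limits along multiples of the block length.\<close>

lemma sum_cyc_periods:
  fixes I :: "nat \<Rightarrow> real"
  shows "(\<Sum>s=1..m * length \<Xi>. I (cyc \<Xi> s)) = real m * (\<Sum>s=1..length \<Xi>. I (cyc \<Xi> s))"
proof (induction m)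
  case 0
  then show ?case by simp
next
  case (Suc m)
  let ?l = "length \<Xi>"
  have "(\<Sum>s=1..Suc m * ?l. I (cyc \<Xi> s))
      = (\<Sum>s=1..m * ?l. I (cyc \<Xi> s)) + (\<Sum>s=m * ?l + 1..m * ?l + ?l. I (cyc \<Xi> s))"
    using sum.ub_add_nat[of 1 "m * ?l" "\<lambda>s. I (cyc \<Xi> s)" ?l] by (simp add: add.commute)
  also have "(\<Sum>s=m * ?l + 1..m * ?l + ?l. I (cyc \<Xi> s)) = (\<Sum>s=1..?l. I (cyc \<Xi> (m * ?l + s)))"
    using sum.shift_bounds_cl_nat_ivl[of "\<lambda>s. I (cyc \<Xi> s)" 1 "m * ?l" ?l]
    by (simp add: add.commute)
  also have "\<dots> = (\<Sum>s=1..?l. I (cyc \<Xi> s))"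
    by (intro sum.cong) (auto simp: cyc_add_period)
  finally show ?case
    unfolding Suc.IH by (simp add: algebra_simps)
qed

text \<open>Induction on the horizon \<open>M\<close>: the first treatment joins the prefix, the
  induction hypothesis turns all later ones into \<open>x'\<close>, and \<open>dominance\<close>
  then replaces the first. Hence \<open>z\<close> and \<open>t\<close> vary in the
  induction.\<close>

lemma sum_gain_le_constant:
  fixes I :: "nat \<Rightarrow> real" and \<pi> :: "nat list \<Rightarrow> real" and x :: "nat \<Rightarrow> nat"
  assumes dominance: "\<And>x M z. x \<in> A \<Longrightarrow> M \<ge> 1 \<Longrightarrow> z \<noteq> [] \<Longrightarrow> set z \<subseteq> A \<Longrightarrow>
          I x + (\<Sum>s=1..M. omega (\<pi> (z @ x # replicate (s - 1) x')))
        \<le> I x' + (\<Sum>s=1..M. omega (\<pi> (z @ replicate s x')))"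
    and "z \<noteq> []" "set z \<subseteq> A" "\<And>s. s \<in> {1..M} \<Longrightarrow> x (t + s) \<in> A"
  shows "(\<Sum>s=1..M. I (x (t + s)) + omega (\<pi> (z @ map x [t + 1..<t + s + 1])))
      \<le> (\<Sum>s=1..M. I x' + omega (\<pi> (z @ replicate s x')))"
  using assms(2-)
proof (induction M arbitrary: z t)
  case 0
  then show ?case by simp
next
  case (Suc M)
  let ?y = "x (t + 1)"
  \<comment> \<open>The omega terms of the path \<open>?y, x', x', ...\<close>, the intermediate
    path between the given and the constant one.\<close>
  let ?R = "\<lambda>s. omega (\<pi> (z @ ?y # replicate (s - 1) x'))"
  have y: "?y \<in> A"
    using Suc.prems(3)[of 1] by simp
  have xA: "x (t + 1 + s) \<in> A" if "s \<in> {1..M}" for s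
    using Suc.prems(3)[of "Suc s"] that by simp
  \<comment> \<open>The first summand is split off, since it is the first treatment that moves into
    the prefix; \<open>sum.cl_ivl_Suc\<close> would split off the last one.\<close>
  have split: "(\<Sum>s=1..Suc M. h s) = h 1 + (\<Sum>s=1..M. h (Suc s))" for h :: "nat \<Rightarrow> real"
    by (subst sum.atLeast_Suc_atMost)
      (simp_all add: sum.shift_bounds_cl_Suc_ivl del: sum.cl_ivl_Suc)
  have path: "map x [t + 1..<t + Suc s + 1] = ?y # map x [t + 1 + 1..<t + 1 + s + 1]" for s
    by (subst upt_conv_Cons) simp_all
  have "(\<Sum>s=1..Suc M. I (x (t + s)) + omega (\<pi> (z @ map x [t + 1..<t + s + 1])))
      = I ?y + ?R 1 + (\<Sum>s=1..M. I (x (t + 1 + s))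
          + omega (\<pi> ((z @ [?y]) @ map x [t + 1 + 1..<t + 1 + s + 1])))"
    unfolding split path by simp
  also have "\<dots> \<le> I ?y + ?R 1 + (\<Sum>s=1..M. I x' + omega (\<pi> ((z @ [?y]) @ replicate s x')))"
    using Suc.IH[of "z @ [?y]" "t + 1"] Suc.prems(2) y xA by (intro add_left_mono) simp
  \<comment> \<open>Apart from \<open>M\<close> copies of \<open>I x'\<close>, what remains is
    exactly the left side of \<open>dominance\<close> at horizon \<open>Suc M\<close>.\<close>
  also have "\<dots> = real M * I x' + (I ?y + (\<Sum>s=1..Suc M. ?R s))"
    unfolding split by (simp add: sum.distrib)
  also have "\<dots> \<le> real M * I x' + (I x' + (\<Sum>s=1..Suc M. omega (\<pi> (z @ replicate s x'))))"
    using dominance[of ?y "Suc M" z] y Suc.prems by (intro add_left_mono) simp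
  also have "\<dots> = (\<Sum>s=1..Suc M. I x' + omega (\<pi> (z @ replicate s x')))"
    by (simp add: sum.distrib algebra_simps)
  finally show ?case .
qed

lemma avg_gain_le_constant:
  assumes "\<And>M. (\<Sum>s=1..M. I (x (length z + s))
              + omega (\<pi> (z @ map x [length z + 1..<length z + s + 1])))
          \<le> (\<Sum>s=1..M. I x' + omega (\<pi> (z @ replicate s x')))"
  shows "avg_gain I \<pi> z x \<le> avg_gain I \<pi> z (\<lambda>_. x')"
proof -
  have "map (\<lambda>_. x') [length z + 1..<length z + s + 1] = replicate s x'" for s
    by (simp add: map_replicate_const del: upt_Suc)
  then show ?thesis
    unfolding avg_gain_def using assms
    by (intro Liminf_mono always_eventually allI)
      (simp add: divide_right_mono del: upt_Suc)
qed

text \<open>At horizons that are multiples of the block length, the divergence average is constant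
  and only the omega average has to converge. The factor \<open>q\<close> lets blocks of different
  lengths be sampled at common horizons; \<open>Suc m\<close> avoids horizon 0, where division by
  zero would give 0.\<close>

lemma block_D_limit:
  assumes "block_rate K \<pi> \<Xi> (d \<Xi>)" "\<Xi> \<noteq> []" "set z \<subseteq> {1..K}" "q \<ge> 1"
  shows "(\<lambda>m. (1 / real (Suc m * (q * length \<Xi>))) * (\<Sum>s=1..Suc m * (q * length \<Xi>).
            I (cyc \<Xi> s) + omega (\<pi> (z @ map (cyc \<Xi>) [1..<s + 1]))))
         \<longlonglongrightarrow> block_D I d \<Xi>"
proof -
  let ?l = "length \<Xi>"
  let ?a = "\<lambda>M. (1 / real M) * (\<Sum>s=1..M. omega (\<pi> (z @ map (cyc \<Xi>) [1..<s + 1])))"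
  \<comment> \<open>Uniform convergence is used only pointwise, at the prefix \<open>z\<close> and
    with the block read from its first entry.\<close>
  have "(z, 1) \<in> lists {1..K} \<times> {1..?l}"
    using assms(2,3) by (auto simp: in_lists_conv_set Suc_le_eq)
  from tendsto_uniform_limitI[OF assms(1)[unfolded block_rate_def] this]
  have "?a \<longlonglongrightarrow> d \<Xi>"
    by (simp add: cyc_seg_def del: upt_Suc)
  moreover have "strict_mono (\<lambda>m. Suc m * (q * ?l))"
    using assms(2,4) by (intro strict_monoI mult_strict_right_mono) auto
  ultimately have "(\<lambda>m. ?a (Suc m * (q * ?l))) \<longlonglongrightarrow> d \<Xi>"
    using LIMSEQ_subseq_LIMSEQ[of ?a "d \<Xi>" "\<lambda>m. Suc m * (q * ?l)"] by (simp only: o_def)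
  then have "(\<lambda>m. (1 / real ?l) * (\<Sum>s=1..?l. I (cyc \<Xi> s)) + ?a (Suc m * (q * ?l)))
      \<longlonglongrightarrow> block_D I d \<Xi>"
    unfolding block_D_def by (intro tendsto_add tendsto_const)
  moreover have "(1 / real (Suc m * (q * ?l))) * (\<Sum>s=1..Suc m * (q * ?l). I (cyc \<Xi> s))
      = (1 / real ?l) * (\<Sum>s=1..?l. I (cyc \<Xi> s))" for m
  proof -
    have cancel: "1 / (a * b) * (a * c) = 1 / b * c" if "a \<noteq> 0" for a b c :: real
      using that by simp
    have nonzero: "real (Suc m * q) \<noteq> 0"
      unfolding of_nat_eq_0_iff using assms(4) by simp
    show ?thesis
      unfolding mult.assoc[of "Suc m" q, symmetric] sum_cyc_periods of_nat_mult[of "Suc m * q"]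
      by (rule cancel[OF nonzero])
  qed
  ultimately show ?thesis
    by (simp only: sum.distrib distrib_left)
qed

theorem lemmaF2:
  fixes K :: nat
    and \<mu> :: "'a measure"
    and f g :: "nat \<Rightarrow> 'a \<Rightarrow> real"
    and I :: "nat \<Rightarrow> real"
    and \<pi> :: "nat list \<Rightarrow> real"
    and d :: "nat list \<Rightarrow> real"
    and x' :: nat
  assumes K: "K \<ge> 2"
    and pi_range: "\<And>t xs. t \<ge> 1 \<Longrightarrow> xs \<in> nlists t {1..K} \<Longrightarrow> \<pi> xs \<in> {0..<1}"
    and f_density: "\<And>x. x \<in> {1..K} \<Longrightarrow> prob_density \<mu> (f x)"
    and g_density: "\<And>x. x \<in> {1..K} \<Longrightarrow> prob_density \<mu> (g x)"
    and I_finite: "\<And>x. x \<in> {1..K} \<Longrightarrow> KL_finite \<mu> (f x) (g x)"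
    and I_eq: "\<And>x. x \<in> {1..K} \<Longrightarrow> I x = KL_info \<mu> (f x) (g x)"
    and I_pos: "\<And>x. x \<in> {1..K} \<Longrightarrow> I x > 0"
    and d_rate: "\<And>l \<Xi>. l \<ge> 1 \<Longrightarrow> \<Xi> \<in> nlists l {1..K} \<Longrightarrow> d \<Xi> \<ge> 0 \<and> block_rate K \<pi> \<Xi> (d \<Xi>)"
    and x': "x' \<in> {1..K}"
    and dominance: "\<And>x t M z. x \<in> {1..K} \<Longrightarrow> t \<ge> 1 \<Longrightarrow> M \<ge> 1 \<Longrightarrow> z \<in> nlists t {1..K} \<Longrightarrow>
          I x + (\<Sum>s=1..M. omega (\<pi> (z @ x # replicate (s - 1) x')))
        \<le> I x' + (\<Sum>s=1..M. omega (\<pi> (z @ replicate s x')))"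
  shows "(\<forall>t\<ge>1. \<forall>M\<ge>1. \<forall>z\<in>nlists t {1..K}. \<forall>x :: nat \<Rightarrow> nat.
            (\<forall>s\<in>{1..M}. x (t + s) \<in> {1..K}) \<longrightarrow>
            (\<Sum>s=1..M. I (x (t + s)) + omega (\<pi> (z @ map x [t + 1..<t + s + 1])))
              \<le> (\<Sum>s=1..M. I x' + omega (\<pi> (z @ replicate s x'))))
       \<and> (\<forall>t\<ge>1. \<forall>z\<in>nlists t {1..K}.
            avg_gain I \<pi> z (\<lambda>_. x')
              = (SUP x \<in> {x. \<forall>s\<ge>1. x (t + s) \<in> {1..K}}. avg_gain I \<pi> z x))
       \<and> is_arg_max (block_D I d) (\<lambda>\<Xi>. \<exists>l\<ge>1. \<Xi> \<in> nlists l {1..K}) [x']"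
proof (intro conjI allI impI ballI)
  have sum_le: "(\<Sum>s=1..M. I (x (t + s)) + omega (\<pi> (z @ map x [t + 1..<t + s + 1])))
      \<le> (\<Sum>s=1..M. I x' + omega (\<pi> (z @ replicate s x')))"
    if "t \<ge> 1" "z \<in> nlists t {1..K}" "\<forall>s\<in>{1..M}. x (t + s) \<in> {1..K}" for t z M x
  proof (rule sum_gain_le_constant[where A = "{1..K}"])
    \<comment> \<open>The hypothesis of the theorem is indexed by the length \<open>t\<close> of the
      prefix; it is instantiated with the length of \<open>w\<close>.\<close>
    fix y M' w
    assume y: "y \<in> {1..K}" and M': "M' \<ge> (1::nat)" and w: "w \<noteq> []" "set w \<subseteq> {1..K}"
    have "length w \<ge> 1"
      using w(1) by (cases w) simp_all
    moreover have "w \<in> nlists (length w) {1..K}"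
      using w(2) by (rule nlistsI[OF refl])
    ultimately show "I y + (\<Sum>s=1..M'. omega (\<pi> (w @ y # replicate (s - 1) x')))
        \<le> I x' + (\<Sum>s=1..M'. omega (\<pi> (w @ replicate s x')))"
      by (rule dominance[OF y _ M'])
  qed (use that in \<open>auto simp: nlists_def\<close>)

  show "(\<Sum>s=1..M. I (x (t + s)) + omega (\<pi> (z @ map x [t + 1..<t + s + 1])))
      \<le> (\<Sum>s=1..M. I x' + omega (\<pi> (z @ replicate s x')))"
    if "1 \<le> t" "1 \<le> M" "z \<in> nlists t {1..K}" "\<forall>s\<in>{1..M}. x (t + s) \<in> {1..K}" for t M z x
    using that(1,3,4) by (rule sum_le)

  show "avg_gain I \<pi> z (\<lambda>_. x') = (SUP x \<in> {x. \<forall>s\<ge>1. x (t + s) \<in> {1..K}}. avg_gain I \<pi> z x)"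
    if t: "1 \<le> t" and z: "z \<in> nlists t {1..K}" for t z
  proof (rule antisym)
    show "avg_gain I \<pi> z (\<lambda>_. x') \<le> (SUP x \<in> {x. \<forall>s\<ge>1. x (t + s) \<in> {1..K}}. avg_gain I \<pi> z x)"
      using x' by (intro SUP_upper) simp
    show "(SUP x \<in> {x. \<forall>s\<ge>1. x (t + s) \<in> {1..K}}. avg_gain I \<pi> z x) \<le> avg_gain I \<pi> z (\<lambda>_. x')"
    proof (intro SUP_least avg_gain_le_constant)
      fix x M assume "x \<in> {x. \<forall>s\<ge>1. x (t + s) \<in> {1..K}}"
      moreover have "length z = t"
        using z by (simp add: nlists_def)
      ultimately show "(\<Sum>s=1..M. I (x (length z + s))
            + omega (\<pi> (z @ map x [length z + 1..<length z + s + 1])))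
          \<le> (\<Sum>s=1..M. I x' + omega (\<pi> (z @ replicate s x')))"
        using t z by (intro sum_le) auto
    qed
  qed

  show "is_arg_max (block_D I d) (\<lambda>\<Xi>. \<exists>l\<ge>1. \<Xi> \<in> nlists l {1..K}) [x']"
    unfolding is_arg_max_linorder
  proof (intro conjI allI impI)
    have x'_block: "[x'] \<in> nlists 1 {1..K}"
      using x' by (simp add: nlists_def)
    then show "\<exists>l\<ge>1. [x'] \<in> nlists l {1..K}"
      by (intro exI[of _ 1]) simp
    fix \<Xi> assume "\<exists>l\<ge>1. \<Xi> \<in> nlists l {1..K}"
    then obtain l where "l \<ge> 1" "\<Xi> \<in> nlists l {1..K}"
      by blast
    then have \<Xi>: "length \<Xi> \<ge> 1" "\<Xi> \<in> nlists (length \<Xi>) {1..K}" "\<Xi> \<noteq> []" "set \<Xi> \<subseteq> {1..K}"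
      by (auto simp: nlists_def)
    let ?l = "length \<Xi>"
    \<comment> \<open>The limit is the same for every prefix, while (i) requires a nonempty one;
      \<open>[x']\<close> serves for both blocks.\<close>
    let ?g = "\<lambda>B M. (1 / real M) * (\<Sum>s=1..M.
        I (cyc B s) + omega (\<pi> ([x'] @ map (cyc B) [1..<s + 1])))"
    \<comment> \<open>Taking \<open>q = 1\<close> for \<open>\<Xi>\<close> and \<open>q = ?l\<close>
      for \<open>[x']\<close> makes both averages run over the horizons
      \<open>Suc m * ?l\<close>.\<close>
    have lim: "(\<lambda>m. ?g \<Xi> (Suc m * (1 * ?l))) \<longlonglongrightarrow> block_D I d \<Xi>"
      using d_rate[OF \<Xi>(1,2)] \<Xi>(3) x' by (intro block_D_limit[where K = K]) auto
    have lim': "(\<lambda>m. ?g [x'] (Suc m * (?l * length [x']))) \<longlonglongrightarrow> block_D I d [x']"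
      using d_rate[OF order_refl x'_block] \<Xi>(1) x' by (intro block_D_limit[where K = K]) auto
    have le: "?g \<Xi> M \<le> ?g [x'] M" for M
    proof (intro mult_left_mono)
      \<comment> \<open>The prefix occupies time 1, so the block is delayed by one step:
        \<open>?x (1 + s)\<close> is \<open>cyc \<Xi> s\<close>.\<close>
      let ?x = "\<lambda>n. cyc \<Xi> (n - 1)"
      have path: "map ?x [1 + 1..<1 + s + 1] = map (cyc \<Xi>) [1..<s + 1]" for s
        by (intro nth_equalityI) (simp_all del: upt_Suc)
      have const: "map (cyc [x']) [1..<s + 1] = replicate s x'" for s
        by (intro nth_equalityI) (simp_all del: upt_Suc)
      have "\<forall>s\<in>{1..M}. ?x (1 + s) \<in> {1..K}"
        using cyc_in_set[OF \<Xi>(3)] \<Xi>(4) by blast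
      from sum_le[where x = ?x, OF order_refl x'_block this]
      show "(\<Sum>s=1..M. I (cyc \<Xi> s) + omega (\<pi> ([x'] @ map (cyc \<Xi>) [1..<s + 1])))
          \<le> (\<Sum>s=1..M. I (cyc [x'] s) + omega (\<pi> ([x'] @ map (cyc [x']) [1..<s + 1])))"
        unfolding path const by simp
    qed simp
    have "?l * length [x'] = 1 * ?l"
      by simp
    then have "?g \<Xi> (Suc m * (1 * ?l)) \<le> ?g [x'] (Suc m * (?l * length [x']))" for m
      by (simp only: le)
    then show "block_D I d [x'] \<ge> block_D I d \<Xi>"
      using LIMSEQ_le[OF lim lim'] by blast
  qed
qed

end
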